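(* Let $\mathcal H^?_*$ be an equivariant homology theory with values in $R$-modules and $\mathcal F$ a class of groups closed under isomorphisms, subgroups and quotients; FIC and FICwF refer to $(\mathcal F,\mathcal H^?_* )$. If FIC holds for all virtually abelian groups, then FICwF holds for all virtually abelian groups.
   Context: All groups are discrete; $R$ is an associative ring with unit. A family of subgroups of a group $G$ is a set of subgroups closed under conjugation and passing to subgroups. For a homomorphism $\varphi:K\to G$ and a family $\mathcal E$ of subgroups of $G$, put $\varphi^*\mathcal E=\{H\le K\mid\varphi(H)\in\mathcal E\}$. $E_{\mathcal E}G$ denotes the $G$-CW-complex, unique up to $G$-homotopy equivalence, all of whose isotropy groups lie in $\mathcal E$ and such that $(E_{\mathcal E}G)^H$ is contractible for every $H\in\mathcal E$. An equivariant homology theory $\mathcal H^?_*$ with values in $R$-modules assigns to every group $G$ a $G$-homology theory $\mathcal H^G_*$ (functors $\mathcal H^G_n$, $n\in\mathbb Z$, from $G$-CW-pairs to $R$-modules with boundary maps, satisfying $G$-homotopy invariance, long exact sequence of a pair, excision, and the disjoint union axiom), together with natural homomorphisms $\operatorname{ind}_\alpha:\mathcal H^H_n(X,A)\to\mathcal H^G_n(G\times_\alpha(X,A))$ for every homomorphism $\alpha:H\to G$ and $H$-CW-pair $(X,A)$, which are compatible with the boundary maps; are functorial, i.e. $\operatorname{ind}_{\beta\circ\alpha}=\mathcal H^K_n(f_1)\circ\operatorname{ind}_\beta\circ\operatorname{ind}_\alpha$ for $\beta:G\to K$ whenever $\ker(\beta\circ\alpha)$ acts freely on $X$, with $f_1(k,g,x)=(k\beta(g),x)$;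 are compatible with conjugation, i.e. for $c(g):G\to G$, $g'\mapsto gg'g^{-1}$, $\operatorname{ind}_{c(g)}$ is induced by the $G$-homeomorphism $x\mapsto(1,g^{-1}x)$; and are bijective whenever $\ker\alpha$ acts freely on $X$. IC: $(G,\mathcal E,\mathcal H^?_* )$ satisfies IC if $E_{\mathcal E}G\to\mathrm{pt}$ induces isomorphisms $\mathcal H^G_n(E_{\mathcal E}G)\to\mathcal H^G_n(\mathrm{pt})$ for all $n\in\mathbb Z$. FIC: $(G,\mathcal E,\mathcal H^?_* )$ satisfies FIC if $(K,\varphi^*\mathcal E,\mathcal H^?_* )$ satisfies IC for every group homomorphism $\varphi:K\to G$. $\mathcal F_G$ is the family of subgroups of $G$ belonging to $\mathcal F$. "FIC holds for $G$" means $(G,\mathcal F_G,\mathcal H^?_* )$ satisfies FIC; "FICwF holds for $G$" means FIC holds for $G\wr H$ for every finite group $H$, where $G\wr H=G^H\rtimes H$ is the regular wreath product. *)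

theory Defs
  imports
    "HOL-Analysis.Analysis"
    "HOL-Algebra.Module"
    "HOL-Algebra.Group_Action"
    "HOL-Algebra.Left_Coset"
    "HOL-Algebra.Product_Groups"
    "HOL-Library.Infinite_Typeclass"
begin

section \<open>Universe conventions\<close>

text \<open>
  HOL has no type of all groups. An arbitrary infinite type \<open>'g\<close> serves as the universe:
  ``every group'' means every group whose carrier is a set of elements of \<open>'g\<close>.  Points of
  equivariant spaces are the elements of \<open>'g set list\<close>.  For infinite \<open>'g\<close> this type has the
  cardinality of the power set of \<open>'g\<close>, hence at least that of the continuum.  It therefore
  contains a model of the classifying space of every family of subgroups of every group in the
  universe (such a group may have as many subgroups as \<open>'g\<close> has subsets), and it is closed under
  adjoining a group coordinate, which is what the construction of \<open>G \<times>\<^sub>\<alpha> X\<close> needs.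
\<close>

type_synonym 'g point = "'g set list"

definition enc :: "'g \<times> 'g point \<Rightarrow> 'g point" where
  "enc p = {fst p} # snd p"

definition dec :: "'g point \<Rightarrow> 'g \<times> 'g point" where
  "dec y = (the_elem (hd y), tl y)"

lemma dec_enc [simp]: "dec (enc p) = p"
  by (simp add: dec_def enc_def)


section \<open>Pairs of \<open>G\<close>-spaces\<close>

text \<open>
  A record stands for a pair \<open>(X, A)\<close> with a group action on \<open>X\<close>.  Absolute spaces are pairs with
  \<open>A = {}\<close>.  As in \<^locale>\<open>group_action\<close>, each action map is extensional on the space.
\<close>

record 'g gpair =
  gtop :: "'g point topology"
  gact :: "'g \<Rightarrow> 'g point \<Rightarrow> 'g point"
  gsub :: "'g point set"

definition restrict_pair :: "'g gpair \<Rightarrow> 'g point set \<Rightarrow> 'g gpair" where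
  "restrict_pair P A =
     \<lparr>gtop = subtopology (gtop P) A, gact = (\<lambda>g. restrict (gact P g) A), gsub = {}\<rparr>"

definition abs_pair :: "'g gpair \<Rightarrow> 'g gpair" where
  "abs_pair P = P\<lparr>gsub := {}\<rparr>"

definition sub_pair :: "'g gpair \<Rightarrow> 'g gpair" where
  "sub_pair P = restrict_pair P (gsub P)"

definition gspace :: "'g monoid \<Rightarrow> 'g gpair \<Rightarrow> bool" where
  "gspace G P \<longleftrightarrow>
     group_action G (topspace (gtop P)) (gact P) \<and>
     (\<forall>g\<in>carrier G. continuous_map (gtop P) (gtop P) (gact P g))"

definition equivariant_map ::
  "'g monoid \<Rightarrow> 'g gpair \<Rightarrow> 'g gpair \<Rightarrow> ('g point \<Rightarrow> 'g point) \<Rightarrow> bool" where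
  "equivariant_map G P Q f \<longleftrightarrow>
     (\<forall>g\<in>carrier G. \<forall>x\<in>topspace (gtop P). f (gact P g x) = gact Q g (f x)) \<and>
     f ` gsub P \<subseteq> gsub Q"

definition gmap ::
  "'g monoid \<Rightarrow> 'g gpair \<Rightarrow> 'g gpair \<Rightarrow> ('g point \<Rightarrow> 'g point) \<Rightarrow> bool" where
  "gmap G P Q f \<longleftrightarrow> continuous_map (gtop P) (gtop Q) f \<and> equivariant_map G P Q f"

definition ghomotopic ::
  "'g monoid \<Rightarrow> 'g gpair \<Rightarrow> 'g gpair \<Rightarrow> ('g point \<Rightarrow> 'g point) \<Rightarrow> ('g point \<Rightarrow> 'g point) \<Rightarrow> bool"
  where "ghomotopic G P Q = homotopic_with (equivariant_map G P Q) (gtop P) (gtop Q)"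


section \<open>\<open>G\<close>-CW-pairs\<close>

definition disc :: "nat \<Rightarrow> (nat \<Rightarrow> real) topology" where
  "disc n = subtopology (Euclidean_space n) {x. (\<Sum>i<n. (x i)\<^sup>2) \<le> 1}"

text \<open>This is empty for \<open>n = 0\<close>.\<close>

definition disc_boundary :: "nat \<Rightarrow> (nat \<Rightarrow> real) set" where
  "disc_boundary n = topspace (disc n) \<inter> {x. (\<Sum>i<n. (x i)\<^sup>2) = 1}"

definition disc_interior :: "nat \<Rightarrow> (nat \<Rightarrow> real) set" where
  "disc_interior n = topspace (disc n) - disc_boundary n"

definition gcell :: "'g monoid \<Rightarrow> 'g set \<Rightarrow> nat \<Rightarrow> ('g set \<times> (nat \<Rightarrow> real)) topology" where
  "gcell G H n = prod_topology (discrete_topology (lcosets\<^bsub>G\<^esub> H)) (disc n)"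

text \<open>
  \<open>cells n\<close> indexes the equivariant \<open>n\<close>-cells \<open>G/H \<times> D\<^sup>n\<close>, with \<open>H = cell_stab n i\<close> and
  characteristic map \<open>char_map n i\<close>.  Indexing by points is no restriction, since distinct
  cells contain distinct points of the space.
\<close>

record 'g gcw_data =
  skel :: "nat \<Rightarrow> 'g point set"
  cells :: "nat \<Rightarrow> 'g point set"
  cell_stab :: "nat \<Rightarrow> 'g point \<Rightarrow> 'g set"
  char_map :: "nat \<Rightarrow> 'g point \<Rightarrow> 'g set \<times> (nat \<Rightarrow> real) \<Rightarrow> 'g point"

definition lower_skel :: "'g gcw_data \<Rightarrow> nat \<Rightarrow> 'g point set" where
  "lower_skel S n = (case n of 0 \<Rightarrow> {} | Suc m \<Rightarrow> skel S m)"

text \<open>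
  The last two conjuncts say that the square formed by
  \<open>\<Squnion>\<^sub>i G/H\<^sub>i \<times> S\<^sup>n\<^sup>-\<^sup>1 \<rightarrow> X\<^sub>n\<^sub>-\<^sub>1\<close> and \<open>\<Squnion>\<^sub>i G/H\<^sub>i \<times> D\<^sup>n \<rightarrow> X\<^sub>n\<close>
  is a pushout of sets and that \<open>X\<^sub>n\<close> has the pushout topology.
\<close>

definition attaches_cells :: "'g monoid \<Rightarrow> 'g gpair \<Rightarrow> 'g gcw_data \<Rightarrow> nat \<Rightarrow> bool" where
  "attaches_cells G P S n \<longleftrightarrow>
     lower_skel S n \<subseteq> skel S n \<and>
     (\<forall>i\<in>cells S n.
        subgroup (cell_stab S n i) G \<and>
        continuous_map (gcell G (cell_stab S n i) n) (subtopology (gtop P) (skel S n))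
          (char_map S n i) \<and>
        (\<forall>g\<in>carrier G. \<forall>c\<in>lcosets\<^bsub>G\<^esub> (cell_stab S n i). \<forall>z\<in>topspace (disc n).
           char_map S n i (g <#\<^bsub>G\<^esub> c, z) = gact P g (char_map S n i (c, z))) \<and>
        char_map S n i ` ((lcosets\<^bsub>G\<^esub> (cell_stab S n i)) \<times> disc_boundary n) \<subseteq> lower_skel S n) \<and>
     bij_betw (\<lambda>(i, z). char_map S n i z)
       (SIGMA i:cells S n. (lcosets\<^bsub>G\<^esub> (cell_stab S n i)) \<times> disc_interior n)
       (skel S n - lower_skel S n) \<and>
     (\<forall>U\<subseteq>skel S n.
        openin (subtopology (gtop P) (lower_skel S n)) (U \<inter> lower_skel S n) \<and>
        (\<forall>i\<in>cells S n.
           openin (gcell G (cell_stab S n i) n)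
             {z \<in> topspace (gcell G (cell_stab S n i) n). char_map S n i z \<in> U})
        \<longrightarrow> openin (subtopology (gtop P) (skel S n)) U)"

definition gcw_structure :: "'g monoid \<Rightarrow> 'g gpair \<Rightarrow> 'g gcw_data \<Rightarrow> bool" where
  "gcw_structure G P S \<longleftrightarrow>
     gspace G P \<and>
     (\<forall>n. attaches_cells G P S n) \<and>
     (\<Union>n. skel S n) = topspace (gtop P) \<and>
     (\<forall>U\<subseteq>topspace (gtop P).
        (\<forall>n. openin (subtopology (gtop P) (skel S n)) (U \<inter> skel S n)) \<longrightarrow> openin (gtop P) U)"

definition open_gcell :: "'g monoid \<Rightarrow> 'g gcw_data \<Rightarrow> nat \<Rightarrow> 'g point \<Rightarrow> 'g point set" where
  "open_gcell G S n i =
     char_map S n i ` ((lcosets\<^bsub>G\<^esub> (cell_stab S n i)) \<times> disc_interior n)"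

definition gcw_subcomplex ::
  "'g monoid \<Rightarrow> 'g gpair \<Rightarrow> 'g gcw_data \<Rightarrow> 'g point set \<Rightarrow> bool" where
  "gcw_subcomplex G P S A \<longleftrightarrow>
     closedin (gtop P) A \<and>
     (\<exists>D. (\<forall>n. D n \<subseteq> cells S n) \<and> A = (\<Union>n. \<Union>i\<in>D n. open_gcell G S n i))"

definition gcw_pair_structure :: "'g monoid \<Rightarrow> 'g gpair \<Rightarrow> 'g gcw_data \<Rightarrow> bool" where
  "gcw_pair_structure G P S \<longleftrightarrow> gcw_structure G P S \<and> gcw_subcomplex G P S (gsub P)"

definition gcw_pair :: "'g monoid \<Rightarrow> 'g gpair \<Rightarrow> bool" where
  "gcw_pair G P \<longleftrightarrow> (\<exists>S. gcw_pair_structure G P S)"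

definition gcw_complex :: "'g monoid \<Rightarrow> 'g gpair \<Rightarrow> bool" where
  "gcw_complex G P \<longleftrightarrow> gcw_pair G P \<and> gsub P = {}"

text \<open>
  \<open>Y\<close> is the adjunction space \<open>X \<union>\<^sub>f B\<close> of a cellular map \<open>f : A \<rightarrow> B\<close>, where \<open>P = (X, A)\<close>,
  \<open>Q = (Y, B)\<close>, and \<open>F : X \<rightarrow> Y\<close> is the structure map extending \<open>f\<close>.
\<close>

definition cellular_pushout ::
  "'g monoid \<Rightarrow> 'g gpair \<Rightarrow> 'g gpair \<Rightarrow> ('g point \<Rightarrow> 'g point) \<Rightarrow> bool" where
  "cellular_pushout G P Q F \<longleftrightarrow>
     gmap G P Q F \<and>
     (\<exists>S S'. gcw_pair_structure G P S \<and> gcw_pair_structure G Q S' \<and>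
        (\<forall>n. F ` (gsub P \<inter> skel S n) \<subseteq> skel S' n)) \<and>
     bij_betw F (topspace (gtop P) - gsub P) (topspace (gtop Q) - gsub Q) \<and>
     (\<forall>U\<subseteq>topspace (gtop Q).
        openin (gtop P) {x \<in> topspace (gtop P). F x \<in> U} \<and>
        openin (subtopology (gtop Q) (gsub Q)) (U \<inter> gsub Q)
        \<longrightarrow> openin (gtop Q) U)"


section \<open>Induction \<open>G \<times>\<^sub>\<alpha> X\<close>\<close>

definition quotient_topology :: "'a topology \<Rightarrow> ('a \<Rightarrow> 'b) \<Rightarrow> 'b topology" where
  "quotient_topology X q =
     topology (\<lambda>U. U \<subseteq> q ` topspace X \<and> openin X {x \<in> topspace X. q x \<in> U})"

lemma openin_quotient_topology:
  "openin (quotient_topology X q) U \<longleftrightarrow>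
     U \<subseteq> q ` topspace X \<and> openin X {x \<in> topspace X. q x \<in> U}"
proof -
  let ?L = "\<lambda>U. U \<subseteq> q ` topspace X \<and> openin X {x \<in> topspace X. q x \<in> U}"
  have 1: "?L (U \<inter> V)" if "?L U" "?L V" for U V
  proof -
    have "{x \<in> topspace X. q x \<in> U \<inter> V} =
        {x \<in> topspace X. q x \<in> U} \<inter> {x \<in> topspace X. q x \<in> V}" by fast
    moreover have "openin X ({x \<in> topspace X. q x \<in> U} \<inter> {x \<in> topspace X. q x \<in> V})"
      using that by (intro openin_Int) simp_all
    ultimately show ?thesis using that by (simp only:) fast
  qed
  have 2: "?L (\<Union>\<U>)" if "\<forall>U\<in>\<U>. ?L U" for \<U>
  proof -
    have "{x \<in> topspace X. q x \<in> \<Union>\<U>} = \<Union> ((\<lambda>U. {x \<in> topspace X. q x \<in> U}) ` \<U>)" by fast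
    moreover have "openin X (\<Union> ((\<lambda>U. {x \<in> topspace X. q x \<in> U}) ` \<U>))"
      using that by (intro openin_Union) fast
    ultimately show ?thesis using that by (simp only:) fast
  qed
  have "istopology ?L"
    unfolding istopology_def using 1 2 by (intro conjI allI impI) simp_all
  then show ?thesis by (simp add: quotient_topology_def)
qed

lemma topspace_quotient_topology [simp]:
  "topspace (quotient_topology X q) = q ` topspace X"
proof
  have "openin (quotient_topology X q) (topspace (quotient_topology X q))" by simp
  then show "topspace (quotient_topology X q) \<subseteq> q ` topspace X"
    unfolding openin_quotient_topology by (rule conjunct1)
  have "{x \<in> topspace X. q x \<in> q ` topspace X} = topspace X" by fast
  then have "openin (quotient_topology X q) (q ` topspace X)"
    by (simp add: openin_quotient_topology)
  then show "q ` topspace X \<subseteq> topspace (quotient_topology X q)"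
    by (rule openin_subset)
qed

lemma quotient_map_quotient_topology: "quotient_map X (quotient_topology X q) q"
  unfolding quotient_map_def openin_quotient_topology topspace_quotient_topology by blast

text \<open>
  \<open>G \<times>\<^sub>\<alpha> X\<close> is the quotient of \<open>G \<times> X\<close> by the right action \<open>(g, x) \<cdot> h = (g \<alpha>(h), h\<^sup>-\<^sup>1 x)\<close> of \<open>H\<close>.
  Its points are encoded by chosen representatives of the orbits.
\<close>

definition balanced_class ::
  "'g monoid \<Rightarrow> 'g monoid \<Rightarrow> ('g \<Rightarrow> 'g) \<Rightarrow> 'g gpair \<Rightarrow> 'g \<times> 'g point \<Rightarrow> ('g \<times> 'g point) set" where
  "balanced_class H G \<alpha> P p =
     {(fst p \<otimes>\<^bsub>G\<^esub> \<alpha> h, gact P (inv\<^bsub>H\<^esub> h) (snd p)) | h. h \<in> carrier H}"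

definition balanced_proj ::
  "'g monoid \<Rightarrow> 'g monoid \<Rightarrow> ('g \<Rightarrow> 'g) \<Rightarrow> 'g gpair \<Rightarrow> 'g \<times> 'g point \<Rightarrow> 'g point" where
  "balanced_proj H G \<alpha> P p = enc (SOME p'. p' \<in> balanced_class H G \<alpha> P p)"

definition ind_pair ::
  "'g monoid \<Rightarrow> 'g monoid \<Rightarrow> ('g \<Rightarrow> 'g) \<Rightarrow> 'g gpair \<Rightarrow> 'g gpair" where
  "ind_pair H G \<alpha> P =
     \<lparr>gtop = quotient_topology (prod_topology (discrete_topology (carrier G)) (gtop P))
               (balanced_proj H G \<alpha> P),
      gact = (\<lambda>g'. \<lambda>y\<in>balanced_proj H G \<alpha> P ` (carrier G \<times> topspace (gtop P)).
                case dec y of (g, x) \<Rightarrow> balanced_proj H G \<alpha> P (g' \<otimes>\<^bsub>G\<^esub> g, x)),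
      gsub = balanced_proj H G \<alpha> P ` (carrier G \<times> gsub P)\<rparr>"

definition ind_map ::
  "'g monoid \<Rightarrow> 'g monoid \<Rightarrow> ('g \<Rightarrow> 'g) \<Rightarrow> 'g gpair \<Rightarrow> ('g point \<Rightarrow> 'g point) \<Rightarrow>
    'g point \<Rightarrow> 'g point" where
  "ind_map H G \<alpha> Q f y = (case dec y of (g, x) \<Rightarrow> balanced_proj H G \<alpha> Q (g, f x))"

text \<open>The map \<open>f\<^sub>1 : K \<times>\<^sub>\<beta> (G \<times>\<^sub>\<alpha> X) \<rightarrow> K \<times>\<^bsub>\<beta> \<circ> \<alpha>\<^esub> X\<close>, \<open>(k, g, x) \<mapsto> (k \<beta>(g), x)\<close>.\<close>

definition ind_comp_map ::
  "'g monoid \<Rightarrow> 'g monoid \<Rightarrow> ('g \<Rightarrow> 'g) \<Rightarrow> ('g \<Rightarrow> 'g) \<Rightarrow> 'g gpair \<Rightarrow> 'g point \<Rightarrow> 'g point" where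
  "ind_comp_map H K \<alpha> \<beta> P y =
     (case dec y of (k, z) \<Rightarrow> case dec z of (g, x) \<Rightarrow>
        balanced_proj H K (\<beta> \<circ> \<alpha>) P (k \<otimes>\<^bsub>K\<^esub> \<beta> g, x))"

definition acts_freely :: "'g monoid \<Rightarrow> 'g set \<Rightarrow> 'g gpair \<Rightarrow> bool" where
  "acts_freely G N P \<longleftrightarrow>
     (\<forall>g\<in>N. \<forall>x\<in>topspace (gtop P). gact P g x = x \<longrightarrow> g = \<one>\<^bsub>G\<^esub>)"

definition conjugation :: "'g monoid \<Rightarrow> 'g \<Rightarrow> 'g \<Rightarrow> 'g" where
  "conjugation G g x = g \<otimes>\<^bsub>G\<^esub> x \<otimes>\<^bsub>G\<^esub> inv\<^bsub>G\<^esub> g"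


section \<open>Equivariant homology theories\<close>

text \<open>
  \<^locale>\<open>module\<close> requires a commutative ring of scalars, which is not assumed here.  The
  multiplicative fields of the module record are not used.
\<close>

definition left_module :: "'r ring \<Rightarrow> ('r, 'm) module \<Rightarrow> bool" where
  "left_module R M \<longleftrightarrow>
     ring R \<and> abelian_group M \<and>
     (\<forall>a\<in>carrier R. \<forall>x\<in>carrier M. a \<odot>\<^bsub>M\<^esub> x \<in> carrier M) \<and>
     (\<forall>a\<in>carrier R. \<forall>b\<in>carrier R. \<forall>x\<in>carrier M.
        (a \<oplus>\<^bsub>R\<^esub> b) \<odot>\<^bsub>M\<^esub> x = a \<odot>\<^bsub>M\<^esub> x \<oplus>\<^bsub>M\<^esub> b \<odot>\<^bsub>M\<^esub> x) \<and>
     (\<forall>a\<in>carrier R. \<forall>x\<in>carrier M. \<forall>y\<in>carrier M.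
        a \<odot>\<^bsub>M\<^esub> (x \<oplus>\<^bsub>M\<^esub> y) = a \<odot>\<^bsub>M\<^esub> x \<oplus>\<^bsub>M\<^esub> a \<odot>\<^bsub>M\<^esub> y) \<and>
     (\<forall>a\<in>carrier R. \<forall>b\<in>carrier R. \<forall>x\<in>carrier M.
        (a \<otimes>\<^bsub>R\<^esub> b) \<odot>\<^bsub>M\<^esub> x = a \<odot>\<^bsub>M\<^esub> (b \<odot>\<^bsub>M\<^esub> x)) \<and>
     (\<forall>x\<in>carrier M. \<one>\<^bsub>R\<^esub> \<odot>\<^bsub>M\<^esub> x = x)"

definition left_module_hom ::
  "'r ring \<Rightarrow> ('r, 'm) module \<Rightarrow> ('r, 'm) module \<Rightarrow> ('m \<Rightarrow> 'm) \<Rightarrow> bool" where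
  "left_module_hom R M N f \<longleftrightarrow>
     f \<in> hom (add_monoid M) (add_monoid N) \<and>
     (\<forall>a\<in>carrier R. \<forall>x\<in>carrier M. f (a \<odot>\<^bsub>M\<^esub> x) = a \<odot>\<^bsub>N\<^esub> f x)"

definition exact_at ::
  "('r, 'm) module \<Rightarrow> ('r, 'm) module \<Rightarrow> ('r, 'm) module \<Rightarrow> ('m \<Rightarrow> 'm) \<Rightarrow> ('m \<Rightarrow> 'm) \<Rightarrow> bool"
  where
  "exact_at L M N f g \<longleftrightarrow> f ` carrier L = kernel (add_monoid M) (add_monoid N) g"

text \<open>
  \<open>hmod T G n (X, A)\<close> is \<open>H\<^sub>n\<^sup>G(X, A)\<close>; \<open>hmap T G n P Q f\<close> is the map induced by \<open>f : P \<rightarrow> Q\<close>;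
  \<open>hbd T G n (X, A)\<close> is the boundary map \<open>H\<^sub>n\<^sup>G(X, A) \<rightarrow> H\<^sub>n\<^sub>-\<^sub>1\<^sup>G(A)\<close>; and
  \<open>hind T H G \<alpha> n (X, A)\<close> is \<open>ind\<^sub>\<alpha> : H\<^sub>n\<^sup>H(X, A) \<rightarrow> H\<^sub>n\<^sup>G(G \<times>\<^sub>\<alpha> (X, A))\<close>.
\<close>

record ('g, 'r, 'm) homology_data =
  hmod :: "'g monoid \<Rightarrow> int \<Rightarrow> 'g gpair \<Rightarrow> ('r, 'm) module"
  hmap :: "'g monoid \<Rightarrow> int \<Rightarrow> 'g gpair \<Rightarrow> 'g gpair \<Rightarrow> ('g point \<Rightarrow> 'g point) \<Rightarrow> 'm \<Rightarrow> 'm"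
  hbd :: "'g monoid \<Rightarrow> int \<Rightarrow> 'g gpair \<Rightarrow> 'm \<Rightarrow> 'm"
  hind :: "'g monoid \<Rightarrow> 'g monoid \<Rightarrow> ('g \<Rightarrow> 'g) \<Rightarrow> int \<Rightarrow> 'g gpair \<Rightarrow> 'm \<Rightarrow> 'm"

definition homology_functor ::
  "'r ring \<Rightarrow> ('g, 'r, 'm) homology_data \<Rightarrow> 'g monoid \<Rightarrow> bool" where
  "homology_functor R T G \<longleftrightarrow>
     (\<forall>n P. gcw_pair G P \<longrightarrow> left_module R (hmod T G n P)) \<and>
     (\<forall>n P Q f. gcw_pair G P \<and> gcw_pair G Q \<and> gmap G P Q f \<longrightarrow>
        left_module_hom R (hmod T G n P) (hmod T G n Q) (hmap T G n P Q f)) \<and>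
     (\<forall>n P. gcw_pair G P \<longrightarrow>
        (\<forall>u\<in>carrier (hmod T G n P). hmap T G n P P (\<lambda>x. x) u = u)) \<and>
     (\<forall>n P Q Q' f f'.
        gcw_pair G P \<and> gcw_pair G Q \<and> gcw_pair G Q' \<and> gmap G P Q f \<and> gmap G Q Q' f' \<longrightarrow>
        (\<forall>u\<in>carrier (hmod T G n P).
           hmap T G n P Q' (f' \<circ> f) u = hmap T G n Q Q' f' (hmap T G n P Q f u)))"

definition homology_boundary ::
  "'r ring \<Rightarrow> ('g, 'r, 'm) homology_data \<Rightarrow> 'g monoid \<Rightarrow> bool" where
  "homology_boundary R T G \<longleftrightarrow>
     (\<forall>n P. gcw_pair G P \<longrightarrow>
        left_module_hom R (hmod T G n P) (hmod T G (n - 1) (sub_pair P)) (hbd T G n P)) \<and>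
     (\<forall>n P Q f. gcw_pair G P \<and> gcw_pair G Q \<and> gmap G P Q f \<longrightarrow>
        (\<forall>u\<in>carrier (hmod T G n P).
           hbd T G n Q (hmap T G n P Q f u) =
           hmap T G (n - 1) (sub_pair P) (sub_pair Q) f (hbd T G n P u)))"

definition homotopy_invariance :: "('g, 'r, 'm) homology_data \<Rightarrow> 'g monoid \<Rightarrow> bool" where
  "homotopy_invariance T G \<longleftrightarrow>
     (\<forall>n P Q f f'. gcw_pair G P \<and> gcw_pair G Q \<and> ghomotopic G P Q f f' \<longrightarrow>
        (\<forall>u\<in>carrier (hmod T G n P). hmap T G n P Q f u = hmap T G n P Q f' u))"

definition long_exact_sequence :: "('g, 'r, 'm) homology_data \<Rightarrow> 'g monoid \<Rightarrow> bool" where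
  "long_exact_sequence T G \<longleftrightarrow>
     (\<forall>n P. gcw_pair G P \<longrightarrow>
        exact_at (hmod T G (n + 1) P) (hmod T G n (sub_pair P)) (hmod T G n (abs_pair P))
          (hbd T G (n + 1) P) (hmap T G n (sub_pair P) (abs_pair P) (\<lambda>x. x)) \<and>
        exact_at (hmod T G n (sub_pair P)) (hmod T G n (abs_pair P)) (hmod T G n P)
          (hmap T G n (sub_pair P) (abs_pair P) (\<lambda>x. x)) (hmap T G n (abs_pair P) P (\<lambda>x. x)) \<and>
        exact_at (hmod T G n (abs_pair P)) (hmod T G n P) (hmod T G (n - 1) (sub_pair P))
          (hmap T G n (abs_pair P) P (\<lambda>x. x)) (hbd T G n P))"

definition excision :: "('g, 'r, 'm) homology_data \<Rightarrow> 'g monoid \<Rightarrow> bool" where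
  "excision T G \<longleftrightarrow>
     (\<forall>n P Q F. cellular_pushout G P Q F \<longrightarrow>
        bij_betw (hmap T G n P Q F) (carrier (hmod T G n P)) (carrier (hmod T G n Q)))"

text \<open>
  A disjoint union is given as a complex together with a partition \<open>\<U>\<close> into open subcomplexes.
\<close>

definition disjoint_union_axiom :: "('g, 'r, 'm) homology_data \<Rightarrow> 'g monoid \<Rightarrow> bool" where
  "disjoint_union_axiom T G \<longleftrightarrow>
     (\<forall>n P \<U>. gcw_complex G P \<and> pairwise disjnt \<U> \<and> \<Union>\<U> = topspace (gtop P) \<and>
        (\<forall>U\<in>\<U>. openin (gtop P) U \<and> gcw_complex G (restrict_pair P U)) \<longrightarrow>
        bij_betw
          (\<lambda>v. finsum (hmod T G n P)
             (\<lambda>U. hmap T G n (restrict_pair P U) P (\<lambda>x. x) (v U))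
             {U \<in> \<U>. v U \<noteq> \<zero>\<^bsub>hmod T G n (restrict_pair P U)\<^esub>})
          (carrier (sum_group \<U> (\<lambda>U. add_monoid (hmod T G n (restrict_pair P U)))))
          (carrier (hmod T G n P)))"

definition G_homology_theory ::
  "'r ring \<Rightarrow> ('g, 'r, 'm) homology_data \<Rightarrow> 'g monoid \<Rightarrow> bool" where
  "G_homology_theory R T G \<longleftrightarrow>
     homology_functor R T G \<and> homology_boundary R T G \<and> homotopy_invariance T G \<and>
     long_exact_sequence T G \<and> excision T G \<and> disjoint_union_axiom T G"

text \<open>
  The second conjunct says that \<open>ind\<^sub>\<alpha>\<close> depends only on the values of \<open>\<alpha>\<close> on the group.
\<close>

definition induction_natural ::
  "'r ring \<Rightarrow> ('g, 'r, 'm) homology_data \<Rightarrow> bool" where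
  "induction_natural R T \<longleftrightarrow>
     (\<forall>H G \<alpha> n P. group H \<and> group G \<and> \<alpha> \<in> hom H G \<and> gcw_pair H P \<longrightarrow>
        left_module_hom R (hmod T H n P) (hmod T G n (ind_pair H G \<alpha> P)) (hind T H G \<alpha> n P)) \<and>
     (\<forall>H G \<alpha> \<alpha>' n P. group H \<and> group G \<and> \<alpha> \<in> hom H G \<and> (\<forall>h\<in>carrier H. \<alpha> h = \<alpha>' h) \<and>
        gcw_pair H P \<longrightarrow>
        (\<forall>u\<in>carrier (hmod T H n P). hind T H G \<alpha> n P u = hind T H G \<alpha>' n P u)) \<and>
     (\<forall>H G \<alpha> n P Q f. group H \<and> group G \<and> \<alpha> \<in> hom H G \<and>
        gcw_pair H P \<and> gcw_pair H Q \<and> gmap H P Q f \<longrightarrow>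
        (\<forall>u\<in>carrier (hmod T H n P).
           hind T H G \<alpha> n Q (hmap T H n P Q f u) =
           hmap T G n (ind_pair H G \<alpha> P) (ind_pair H G \<alpha> Q) (ind_map H G \<alpha> Q f)
             (hind T H G \<alpha> n P u)))"

text \<open>The inclusion identifies \<open>G \<times>\<^sub>\<alpha> A\<close> with the subspace of \<open>G \<times>\<^sub>\<alpha> X\<close> that it covers.\<close>

definition induction_boundary :: "('g, 'r, 'm) homology_data \<Rightarrow> bool" where
  "induction_boundary T \<longleftrightarrow>
     (\<forall>H G \<alpha> n P. group H \<and> group G \<and> \<alpha> \<in> hom H G \<and> gcw_pair H P \<longrightarrow>
        (\<forall>u\<in>carrier (hmod T H n P).
           hbd T G n (ind_pair H G \<alpha> P) (hind T H G \<alpha> n P u) =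
           hmap T G (n - 1) (ind_pair H G \<alpha> (sub_pair P)) (sub_pair (ind_pair H G \<alpha> P)) (\<lambda>x. x)
             (hind T H G \<alpha> (n - 1) (sub_pair P) (hbd T H n P u))))"

definition induction_functorial :: "('g, 'r, 'm) homology_data \<Rightarrow> bool" where
  "induction_functorial T \<longleftrightarrow>
     (\<forall>H G K \<alpha> \<beta> n P. group H \<and> group G \<and> group K \<and> \<alpha> \<in> hom H G \<and> \<beta> \<in> hom G K \<and>
        gcw_pair H P \<and> acts_freely H (kernel H K (\<beta> \<circ> \<alpha>)) P \<longrightarrow>
        (\<forall>u\<in>carrier (hmod T H n P).
           hind T H K (\<beta> \<circ> \<alpha>) n P u =
           hmap T K n (ind_pair G K \<beta> (ind_pair H G \<alpha> P)) (ind_pair H K (\<beta> \<circ> \<alpha>) P)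
             (ind_comp_map H K \<alpha> \<beta> P)
             (hind T G K \<beta> n (ind_pair H G \<alpha> P) (hind T H G \<alpha> n P u))))"

definition induction_conjugation :: "('g, 'r, 'm) homology_data \<Rightarrow> bool" where
  "induction_conjugation T \<longleftrightarrow>
     (\<forall>G g n P. group G \<and> g \<in> carrier G \<and> gcw_pair G P \<longrightarrow>
        (\<forall>u\<in>carrier (hmod T G n P).
           hind T G G (conjugation G g) n P u =
           hmap T G n P (ind_pair G G (conjugation G g) P)
             (\<lambda>x. balanced_proj G G (conjugation G g) P (\<one>\<^bsub>G\<^esub>, gact P (inv\<^bsub>G\<^esub> g) x)) u))"

definition induction_bijective :: "('g, 'r, 'm) homology_data \<Rightarrow> bool" where
  "induction_bijective T \<longleftrightarrow>
     (\<forall>H G \<alpha> n P. group H \<and> group G \<and> \<alpha> \<in> hom H G \<and> gcw_pair H P \<and>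
        acts_freely H (kernel H G \<alpha>) P \<longrightarrow>
        bij_betw (hind T H G \<alpha> n P) (carrier (hmod T H n P))
          (carrier (hmod T G n (ind_pair H G \<alpha> P))))"

definition equivariant_homology_theory ::
  "'r ring \<Rightarrow> ('g, 'r, 'm) homology_data \<Rightarrow> bool" where
  "equivariant_homology_theory R T \<longleftrightarrow>
     (\<forall>G. group G \<longrightarrow> G_homology_theory R T G) \<and>
     induction_natural R T \<and> induction_boundary T \<and> induction_functorial T \<and>
     induction_conjugation T \<and> induction_bijective T"


section \<open>Isomorphism conjectures\<close>

text \<open>\<^const>\<open>contractible_space\<close> holds for the empty space, which has to be excluded.\<close>

definition classifying_space :: "'g monoid \<Rightarrow> 'g set set \<Rightarrow> 'g gpair \<Rightarrow> bool" where
  "classifying_space G \<E> X \<longleftrightarrow>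
     gcw_complex G X \<and>
     (\<forall>x\<in>topspace (gtop X). stabilizer G (gact X) x \<in> \<E>) \<and>
     (\<forall>H\<in>\<E>. {x \<in> topspace (gtop X). \<forall>h\<in>H. gact X h x = x} \<noteq> {} \<and>
        contractible_space
          (subtopology (gtop X) {x \<in> topspace (gtop X). \<forall>h\<in>H. gact X h x = x}))"

definition one_point :: "'g gpair" where
  "one_point =
     \<lparr>gtop = discrete_topology {[]}, gact = (\<lambda>g. \<lambda>x\<in>{[]}. x), gsub = {}\<rparr>"

definition satisfies_IC ::
  "('g, 'r, 'm) homology_data \<Rightarrow> 'g monoid \<Rightarrow> 'g set set \<Rightarrow> bool" where
  "satisfies_IC T G \<E> \<longleftrightarrow>
     (\<forall>X. classifying_space G \<E> X \<longrightarrow>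
        (\<forall>n. bij_betw (hmap T G n X one_point (\<lambda>x. []))
               (carrier (hmod T G n X)) (carrier (hmod T G n one_point))))"

text \<open>
  Below, groups \<open>L\<close> are allowed to live in a type \<open>'l\<close> other than \<open>'g\<close>, so that wreath products can
  be used without transporting them into \<open>'g\<close>.
\<close>

definition pullback_family :: "'g monoid \<Rightarrow> ('g \<Rightarrow> 'l) \<Rightarrow> 'l set set \<Rightarrow> 'g set set" where
  "pullback_family K \<phi> \<E> = {H. subgroup H K \<and> \<phi> ` H \<in> \<E>}"

definition satisfies_FIC ::
  "('g, 'r, 'm) homology_data \<Rightarrow> 'l monoid \<Rightarrow> 'l set set \<Rightarrow> bool" where
  "satisfies_FIC T L \<E> \<longleftrightarrow>
     (\<forall>(K :: 'g monoid) \<phi>. group K \<and> \<phi> \<in> hom K L \<longrightarrow>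
        satisfies_IC T K (pullback_family K \<phi> \<E>))"

definition closed_group_class :: "('g monoid \<Rightarrow> bool) \<Rightarrow> bool" where
  "closed_group_class \<F> \<longleftrightarrow>
     (\<forall>M. \<F> M \<longrightarrow> group M) \<and>
     (\<forall>M N. \<F> M \<and> group N \<and> M \<cong> N \<longrightarrow> \<F> N) \<and>
     (\<forall>M S. \<F> M \<and> subgroup S M \<longrightarrow> \<F> (M\<lparr>carrier := S\<rparr>)) \<and>
     (\<forall>M S N. \<F> M \<and> S \<lhd> M \<and> group N \<and> M Mod S \<cong> N \<longrightarrow> \<F> N)"

definition class_family :: "('g monoid \<Rightarrow> bool) \<Rightarrow> 'l monoid \<Rightarrow> 'l set set" where
  "class_family \<F> L = {S. subgroup S L \<and> (\<exists>M. \<F> M \<and> M \<cong> L\<lparr>carrier := S\<rparr>)}"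

definition FIC_holds ::
  "('g, 'r, 'm) homology_data \<Rightarrow> ('g monoid \<Rightarrow> bool) \<Rightarrow> 'l monoid \<Rightarrow> bool" where
  "FIC_holds T \<F> L \<longleftrightarrow> satisfies_FIC T L (class_family \<F> L)"

text \<open>
  \<open>G \<wr> H = G\<^sup>H \<rtimes> H\<close>, with \<open>H\<close> acting on \<open>G\<^sup>H\<close> by \<open>(h \<cdot> f)(x) = f(h\<^sup>-\<^sup>1 x)\<close>.
\<close>

definition wreath :: "'a monoid \<Rightarrow> 'b monoid \<Rightarrow> (('b \<Rightarrow> 'a) \<times> 'b) monoid" where
  "wreath G H =
     \<lparr>carrier = (carrier H \<rightarrow>\<^sub>E carrier G) \<times> carrier H,
      mult = (\<lambda>(f, h) (f', h').
        (\<lambda>x\<in>carrier H. f x \<otimes>\<^bsub>G\<^esub> f' (inv\<^bsub>H\<^esub> h \<otimes>\<^bsub>H\<^esub> x), h \<otimes>\<^bsub>H\<^esub> h')),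
      one = (\<lambda>x\<in>carrier H. \<one>\<^bsub>G\<^esub>, \<one>\<^bsub>H\<^esub>)\<rparr>"

definition FICwF_holds ::
  "('g, 'r, 'm) homology_data \<Rightarrow> ('g monoid \<Rightarrow> bool) \<Rightarrow> 'g monoid \<Rightarrow> bool" where
  "FICwF_holds T \<F> G \<longleftrightarrow>
     (\<forall>H :: 'g monoid. group H \<and> finite (carrier H) \<longrightarrow> FIC_holds T \<F> (wreath G H))"

definition virtually_abelian :: "'a monoid \<Rightarrow> bool" where
  "virtually_abelian G \<longleftrightarrow>
     group G \<and>
     (\<exists>A. subgroup A G \<and> comm_group (G\<lparr>carrier := A\<rparr>) \<and> finite (rcosets\<^bsub>G\<^esub> A))"

end

theory Submission
  imports Defs "HOL-Algebra.Weak_Morphisms"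
begin

text \<open>
  The wreath product \<open>G \<wr> H\<close> with a finite group \<open>H\<close> is again virtually abelian: if \<open>A\<close> is abelian of
  finite index in \<open>G\<close>, then \<open>A\<^sup>H\<close> is abelian of finite index in \<open>G \<wr> H\<close>. So FIC for virtually abelian
  groups applies to it directly. As FIC is only assumed for groups in the universe \<open>'g\<close>, the
  wreath product is first replaced by an isomorphic copy there; this copy exists because an
  infinite set has as many elements as its finite powers.
\<close>

text \<open>Induction on \<open>I\<close>: an extensional function on \<open>insert i I\<close> is
  determined by its value at \<open>i\<close> and its restriction to \<open>I\<close>, and a pair of
  elements can be coded by one element of an infinite type.\<close>

lemma inj_on_PiE_infinite:
  assumes "finite I"
  shows "\<exists>e :: ('i \<Rightarrow> 'a::infinite) \<Rightarrow> 'a. inj_on e (I \<rightarrow>\<^sub>E UNIV)"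
  using assms
proof induction
  case empty
  show ?case by auto
next
  case (insert i I)
  then obtain e :: "('i \<Rightarrow> 'a) \<Rightarrow> 'a" where e: "inj_on e (I \<rightarrow>\<^sub>E UNIV)"
    by blast
  obtain p :: "'a \<times> 'a \<Rightarrow> 'a" where "inj p"
    using card_of_Times_same_infinite[OF infinite_UNIV[where 'a = 'a]]
    by (auto simp: card_of_ordIso[symmetric] bij_betw_def)
  have "inj_on (\<lambda>f. p (f i, e (restrict f I))) (insert i I \<rightarrow>\<^sub>E UNIV)"
  proof (rule inj_onI)
    fix f g :: "'i \<Rightarrow> 'a"
    assume fg: "f \<in> insert i I \<rightarrow>\<^sub>E UNIV" "g \<in> insert i I \<rightarrow>\<^sub>E UNIV"
      and "p (f i, e (restrict f I)) = p (g i, e (restrict g I))"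
    then have "f i = g i" "restrict f I = restrict g I"
      using \<open>inj p\<close> e by (auto simp: inj_eq inj_on_eq_iff)
    then show "f = g"
      by (intro PiE_ext[OF fg]) (metis insertE restrict_apply')
  qed
  then show ?case by blast
qed

text \<open>Membership in \<open>class_family\<close> depends only on the isomorphism type of the
  subgroup, and \<psi> restricts to an isomorphism from \<open>S\<close> onto its image. The types
  of \<open>L\<close> and \<open>M\<close> may differ, as they do for a wreath product and its
  copy.\<close>

lemma class_family_iso_image:
  assumes "\<psi> \<in> iso L M" "group L" "group M" "subgroup S L"
  shows "\<psi> ` S \<in> class_family \<F> M \<longleftrightarrow> S \<in> class_family \<F> L"
proof -
  interpret L: group L by fact
  interpret S: subgroup S L by fact
  have "group_hom L M \<psi>"
    using assms by (simp add: group_hom_def group_hom_axioms_def iso_imp_homomorphism)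
  then have "subgroup (\<psi> ` S) M"
    using assms(4) by (rule group_hom.subgroup_img_is_subgroup)
  moreover have iso: "L\<lparr>carrier := S\<rparr> \<cong> M\<lparr>carrier := \<psi> ` S\<rparr>"
    using iso_restrict[OF assms(1-4)] by (rule is_isoI)
  moreover have "M\<lparr>carrier := \<psi> ` S\<rparr> \<cong> L\<lparr>carrier := S\<rparr>"
    using group.iso_sym[OF S.subgroup_is_group[OF assms(2)] iso] .
  ultimately show ?thesis
    using assms(4) unfolding class_family_def by (auto intro: iso_trans)
qed

text \<open>A homomorphism \<phi> from \<open>K\<close> to \<open>L\<close> and its composite with
  \<psi> pull back the same family to \<open>K\<close>, so each instance of IC required for
  \<open>L\<close> is an instance already known for \<open>M\<close>.\<close>

lemma FIC_holds_iso:
  fixes T :: "('g, 'r, 'm) homology_data"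
  assumes "\<psi> \<in> iso L M" "group L" "group M" "FIC_holds T \<F> M"
  shows "FIC_holds T \<F> L"
  unfolding FIC_holds_def satisfies_FIC_def
proof (intro allI impI, elim conjE)
  fix K :: "'g monoid" and \<phi>
  assume K: "group K" "\<phi> \<in> hom K L"
  then interpret \<phi>: group_hom K L \<phi>
    using assms by (simp add: group_hom_def group_hom_axioms_def)
  have "\<psi> \<circ> \<phi> \<in> hom K M"
    using hom_compose[OF K(2) iso_imp_homomorphism[OF assms(1)]] .
  then have "satisfies_IC T K (pullback_family K (\<psi> \<circ> \<phi>) (class_family \<F> M))"
    using assms(4) K(1) unfolding FIC_holds_def satisfies_FIC_def by blast
  \<comment> \<open>\<open>conj_cong\<close> supplies \<open>subgroup H K\<close> while the second
    conjunct is rewritten; then \<phi> maps \<open>H\<close> to a subgroup of \<open>L\<close>, as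
    the previous lemma requires.\<close>
  moreover have "pullback_family K (\<psi> \<circ> \<phi>) (class_family \<F> M) =
      pullback_family K \<phi> (class_family \<F> L)"
    using class_family_iso_image[OF assms(1-3) \<phi>.subgroup_img_is_subgroup, where \<F> = \<F>]
    by (simp add: pullback_family_def image_image cong: conj_cong)
  ultimately show "satisfies_IC T K (pullback_family K \<phi> (class_family \<F> L))"
    by simp
qed

lemma virtually_abelian_iso:
  assumes "\<psi> \<in> iso G M" "group M" "virtually_abelian G"
  shows "virtually_abelian M"
proof -
  from assms(3) obtain A where G: "group G" and A: "subgroup A G"
    and comm: "comm_group (G\<lparr>carrier := A\<rparr>)" and fin: "finite (rcosets\<^bsub>G\<^esub> A)"
    unfolding virtually_abelian_def by blast
  interpret group_hom G M \<psi>
    using assms(1,2) G by (simp add: group_hom_def group_hom_axioms_def iso_imp_homomorphism)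
  have sub: "subgroup (\<psi> ` A) M"
    using A by (rule subgroup_img_is_subgroup)
  have "comm_group (M\<lparr>carrier := \<psi> ` A\<rparr>)"
  proof (rule comm_group.iso_imp_comm_group[OF comm])
    show "G\<lparr>carrier := A\<rparr> \<cong> M\<lparr>carrier := \<psi> ` A\<rparr>"
      using iso_restrict[OF assms(1) G assms(2) A] by (rule is_isoI)
    show "monoid (M\<lparr>carrier := \<psi> ` A\<rparr>)"
      using subgroup.subgroup_is_group[OF sub assms(2)] by (rule group.is_monoid)
  qed
  moreover have "\<psi> ` A #>\<^bsub>M\<^esub> \<psi> g = \<psi> ` (A #>\<^bsub>G\<^esub> g)" if "g \<in> carrier G" for g
    using subgroup.mem_carrier[OF A] that by (force simp: r_coset_def)
  \<comment> \<open>Since \<psi> is surjective, every coset representative in \<open>M\<close> has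
    the form \<open>\<psi> g\<close>, so no coset is missed.\<close>
  then have "rcosets\<^bsub>M\<^esub> (\<psi> ` A) \<subseteq> image \<psi> ` (rcosets\<^bsub>G\<^esub> A)"
    using assms(1) unfolding RCOSETS_def iso_iff by blast
  then have "finite (rcosets\<^bsub>M\<^esub> (\<psi> ` A))"
    using fin by (meson finite_imageI finite_subset)
  ultimately show ?thesis
    unfolding virtually_abelian_def using sub assms(2) by blast
qed

lemma group_wreath:
  assumes "group G" "group H"
  shows "group (wreath G H)"
proof -
  interpret G: group G by fact
  interpret H: group H by fact
  show ?thesis
  proof (rule groupI)
    fix a b c assume "a \<in> carrier (wreath G H)" "b \<in> carrier (wreath G H)" "c \<in> carrier (wreath G H)"
    then show "a \<otimes>\<^bsub>wreath G H\<^esub> b \<otimes>\<^bsub>wreath G H\<^esub> c = a \<otimes>\<^bsub>wreath G H\<^esub> (b \<otimes>\<^bsub>wreath G H\<^esub> c)"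
      by (auto simp: wreath_def fun_eq_iff restrict_def H.m_assoc H.inv_mult_group PiE_iff
          intro!: G.m_assoc)
  next
    fix a assume "a \<in> carrier (wreath G H)"
    then obtain f h where a: "a = (f, h)" "f \<in> carrier H \<rightarrow>\<^sub>E carrier G" "h \<in> carrier H"
      by (auto simp: wreath_def)
    \<comment> \<open>The inverse of \<open>(f, h)\<close> is the pointwise inverse of
      \<open>f\<close>, translated by the action of the inverse of \<open>h\<close>;
      \<open>groupI\<close> asks for a left inverse.\<close>
    have "(\<lambda>x\<in>carrier H. inv\<^bsub>G\<^esub> f (h \<otimes>\<^bsub>H\<^esub> x), inv\<^bsub>H\<^esub> h) \<otimes>\<^bsub>wreath G H\<^esub> a = \<one>\<^bsub>wreath G H\<^esub>"
      using a by (auto simp: wreath_def fun_eq_iff restrict_def PiE_iff)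
    moreover have "(\<lambda>x\<in>carrier H. inv\<^bsub>G\<^esub> f (h \<otimes>\<^bsub>H\<^esub> x), inv\<^bsub>H\<^esub> h) \<in> carrier (wreath G H)"
      using a by (auto simp: wreath_def PiE_iff)
    ultimately show "\<exists>y\<in>carrier (wreath G H). y \<otimes>\<^bsub>wreath G H\<^esub> a = \<one>\<^bsub>wreath G H\<^esub>"
      by blast
  qed (auto simp: wreath_def fun_eq_iff restrict_def PiE_iff extensional_def)
qed

text \<open>The elements multiplied from the left have trivial \<open>H\<close>-component, so they
  do not permute the coordinates of \<open>f\<close>: each coordinate runs independently through its
  own coset of \<open>A\<close>, and \<open>h\<close> is kept. This makes the cosets countable
  coordinate by coordinate.\<close>

lemma wreath_r_coset:
  assumes "group G" "group H" "subgroup A G" "f \<in> carrier H \<rightarrow>\<^sub>E carrier G" "h \<in> carrier H"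
  shows "((carrier H \<rightarrow>\<^sub>E A) \<times> {\<one>\<^bsub>H\<^esub>}) #>\<^bsub>wreath G H\<^esub> (f, h) =
    (\<Pi>\<^sub>E x\<in>carrier H. A #>\<^bsub>G\<^esub> f x) \<times> {h}"
proof -
  interpret H: group H by fact
  have 1: "\<exists>a\<in>carrier H \<rightarrow>\<^sub>E A. k = (\<lambda>x\<in>carrier H. a x \<otimes>\<^bsub>G\<^esub> f x)"
    if k: "k \<in> (\<Pi>\<^sub>E x\<in>carrier H. A #>\<^bsub>G\<^esub> f x)" for k
  proof -
    have "\<forall>x\<in>carrier H. \<exists>a\<in>A. k x = a \<otimes>\<^bsub>G\<^esub> f x"
      using k by (auto simp: PiE_iff r_coset_def)
    then obtain a where a: "\<forall>x\<in>carrier H. a x \<in> A \<and> k x = a x \<otimes>\<^bsub>G\<^esub> f x"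
      by metis
    \<comment> \<open>The chosen \<open>a\<close> is arbitrary outside \<open>carrier H\<close>;
      restricting it there makes it an element of the extensional power of \<open>A\<close>.\<close>
    then have "k = (\<lambda>x\<in>carrier H. restrict a (carrier H) x \<otimes>\<^bsub>G\<^esub> f x)"
      using k by (auto simp: PiE_iff extensional_def fun_eq_iff)
    then show ?thesis
      using a by (intro bexI[of _ "restrict a (carrier H)"]) auto
  qed
  have 2: "(\<lambda>x\<in>carrier H. a x \<otimes>\<^bsub>G\<^esub> f x) \<in> (\<Pi>\<^sub>E x\<in>carrier H. A #>\<^bsub>G\<^esub> f x)"
    if "a \<in> carrier H \<rightarrow>\<^sub>E A" for a
    using that by (auto simp: PiE_iff r_coset_def)
  have 3: "(a, \<one>\<^bsub>H\<^esub>) \<otimes>\<^bsub>wreath G H\<^esub> (f, h) = (\<lambda>x\<in>carrier H. a x \<otimes>\<^bsub>G\<^esub> f x, h)" for a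
    using assms(5) by (simp add: wreath_def fun_eq_iff restrict_def)
  show ?thesis
  proof (intro equalityI subsetI)
    fix c
    assume "c \<in> ((carrier H \<rightarrow>\<^sub>E A) \<times> {\<one>\<^bsub>H\<^esub>}) #>\<^bsub>wreath G H\<^esub> (f, h)"
    then obtain a where "a \<in> carrier H \<rightarrow>\<^sub>E A" "c = (a, \<one>\<^bsub>H\<^esub>) \<otimes>\<^bsub>wreath G H\<^esub> (f, h)"
      by (auto simp: r_coset_def)
    then show "c \<in> (\<Pi>\<^sub>E x\<in>carrier H. A #>\<^bsub>G\<^esub> f x) \<times> {h}"
      using 2[of a] by (simp add: 3)
  next
    fix c
    assume "c \<in> (\<Pi>\<^sub>E x\<in>carrier H. A #>\<^bsub>G\<^esub> f x) \<times> {h}"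
    then obtain k where k: "k \<in> (\<Pi>\<^sub>E x\<in>carrier H. A #>\<^bsub>G\<^esub> f x)" "c = (k, h)"
      by auto
    then obtain a where "a \<in> carrier H \<rightarrow>\<^sub>E A" "c = (a, \<one>\<^bsub>H\<^esub>) \<otimes>\<^bsub>wreath G H\<^esub> (f, h)"
      using 1[OF k(1)] 3 by metis
    then show "c \<in> ((carrier H \<rightarrow>\<^sub>E A) \<times> {\<one>\<^bsub>H\<^esub>}) #>\<^bsub>wreath G H\<^esub> (f, h)"
      unfolding r_coset_def by (intro UN_I[of "(a, \<one>\<^bsub>H\<^esub>)"]) simp_all
  qed
qed

text \<open>A coset of the base subgroup \<open>B\<close> is determined by an element of
  \<open>H\<close> and one coset of \<open>A\<close> for each coordinate, which leaves finitely many
  choices.\<close>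

lemma virtually_abelian_wreath:
  assumes "virtually_abelian G" "group H" "finite (carrier H)"
  shows "virtually_abelian (wreath G H)"
proof -
  from assms(1) obtain A where G: "group G" and A: "subgroup A G"
    and comm: "comm_group (G\<lparr>carrier := A\<rparr>)" and fin: "finite (rcosets\<^bsub>G\<^esub> A)"
    unfolding virtually_abelian_def by blast
  interpret G: group G by fact
  interpret H: group H by fact
  interpret A: subgroup A G by fact
  interpret W: group "wreath G H"
    using G assms(2) by (rule group_wreath)
  define B where "B = (carrier H \<rightarrow>\<^sub>E A) \<times> {\<one>\<^bsub>H\<^esub>}"
  \<comment> \<open>Over the identity of \<open>H\<close> the product is pointwise, so
    \<open>B\<close> is the direct power of \<open>A\<close> and inherits commutativity.\<close>
  have mult: "(a, \<one>\<^bsub>H\<^esub>) \<otimes>\<^bsub>wreath G H\<^esub> (b, \<one>\<^bsub>H\<^esub>) = (\<lambda>x\<in>carrier H. a x \<otimes>\<^bsub>G\<^esub> b x, \<one>\<^bsub>H\<^esub>)" for a b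
    by (simp add: wreath_def fun_eq_iff restrict_def)
  have B: "subgroup B (wreath G H)"
  proof (rule W.subgroupI)
    show "B \<subseteq> carrier (wreath G H)"
      using A.subset by (auto simp: B_def wreath_def PiE_iff)
    show "B \<noteq> {}"
      using A.one_closed by (auto simp: B_def PiE_eq_empty_iff simp del: A.one_closed)
    fix a assume a: "a \<in> B"
    then obtain f where f: "a = (f, \<one>\<^bsub>H\<^esub>)" "f \<in> carrier H \<rightarrow>\<^sub>E A"
      by (auto simp: B_def)
    \<comment> \<open>The candidate for the inverse of \<open>a\<close>; a one-sided check
      identifies it through \<open>W.inv_equality\<close>.\<close>
    define b where "b = (\<lambda>x\<in>carrier H. inv\<^bsub>G\<^esub> f x, \<one>\<^bsub>H\<^esub>)"
    have "b \<in> B"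
      using f by (auto simp: b_def B_def PiE_iff)
    moreover have "b \<otimes>\<^bsub>wreath G H\<^esub> a = \<one>\<^bsub>wreath G H\<^esub>"
      using f by (auto simp: b_def mult wreath_def fun_eq_iff restrict_def PiE_iff)
    ultimately show "inv\<^bsub>wreath G H\<^esub> a \<in> B"
      using a \<open>B \<subseteq> carrier (wreath G H)\<close> W.inv_equality[of b a] by auto
  next
    fix a b assume "a \<in> B" "b \<in> B"
    then show "a \<otimes>\<^bsub>wreath G H\<^esub> b \<in> B"
      by (auto simp: B_def mult PiE_iff)
  qed
  have "x \<otimes>\<^bsub>G\<^esub> y = y \<otimes>\<^bsub>G\<^esub> x" if "x \<in> A" "y \<in> A" for x y
    using comm_groupE(4)[OF comm] that by simp
  then have "comm_group ((wreath G H)\<lparr>carrier := B\<rparr>)"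
    using subgroup.subgroup_is_group[OF B W.is_group]
    by (intro group.group_comm_groupI) (auto simp: B_def mult PiE_iff fun_eq_iff restrict_def)
  moreover have "rcosets\<^bsub>wreath G H\<^esub> B \<subseteq>
    (\<lambda>(c, h). Pi\<^sub>E (carrier H) c \<times> {h}) ` ((carrier H \<rightarrow>\<^sub>E rcosets\<^bsub>G\<^esub> A) \<times> carrier H)"
  proof
    fix C assume "C \<in> rcosets\<^bsub>wreath G H\<^esub> B"
    then obtain f h where fh: "f \<in> carrier H \<rightarrow>\<^sub>E carrier G" "h \<in> carrier H"
      and "C = B #>\<^bsub>wreath G H\<^esub> (f, h)"
      by (auto simp: RCOSETS_def wreath_def)
    \<comment> \<open>Restricting the family of cosets leaves its product unchanged and places the
      family in the finite set of extensional functions.\<close>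
    then have "C = Pi\<^sub>E (carrier H) (\<lambda>x\<in>carrier H. A #>\<^bsub>G\<^esub> f x) \<times> {h}"
      using wreath_r_coset[OF G assms(2) A fh] by (simp add: B_def cong: PiE_cong)
    moreover have "(\<lambda>x\<in>carrier H. A #>\<^bsub>G\<^esub> f x) \<in> carrier H \<rightarrow>\<^sub>E rcosets\<^bsub>G\<^esub> A"
      using fh by (auto simp: RCOSETS_def)
    ultimately show "C \<in> (\<lambda>(c, h). Pi\<^sub>E (carrier H) c \<times> {h}) `
        ((carrier H \<rightarrow>\<^sub>E rcosets\<^bsub>G\<^esub> A) \<times> carrier H)"
      using fh(2) by force
  qed
  then have "finite (rcosets\<^bsub>wreath G H\<^esub> B)"
    using fin assms(3) by (meson finite_PiE finite_SigmaI finite_imageI finite_subset)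
  ultimately show ?thesis
    unfolding virtually_abelian_def using B W.is_group by blast
qed

lemma inj_on_wreath:
  fixes G :: "'a::infinite monoid" and H :: "'a monoid"
  assumes "finite (carrier H)"
  shows "\<exists>e :: ('a \<Rightarrow> 'a) \<times> 'a \<Rightarrow> 'a. inj_on e (carrier (wreath G H))"
proof -
  obtain e :: "('a \<Rightarrow> 'a) \<Rightarrow> 'a" where e: "inj_on e (carrier H \<rightarrow>\<^sub>E UNIV)"
    using inj_on_PiE_infinite[OF assms] by blast
  \<comment> \<open>A pair is a function on \<open>bool\<close>, so the same coding lemma also
    provides the pairing that joins the code of \<open>f\<close> to \<open>h\<close>.\<close>
  obtain d :: "(bool \<Rightarrow> 'a) \<Rightarrow> 'a" where d: "inj d"
    using inj_on_PiE_infinite[of "UNIV :: bool set"] by auto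
  have "inj_on (\<lambda>(f, h). d (case_bool (e f) h)) (carrier (wreath G H))"
  proof (rule inj_onI, clarify)
    fix f h f' h'
    assume "(f, h) \<in> carrier (wreath G H)" "(f', h') \<in> carrier (wreath G H)"
      and "d (case_bool (e f) h) = d (case_bool (e f') h')"
    moreover from this have "case_bool (e f) h = case_bool (e f') h'"
      using d by (simp add: inj_eq)
    then have "e f = e f'" "h = h'"
      by (auto dest: fun_cong[of _ _ True] fun_cong[of _ _ False])
    moreover have "carrier H \<rightarrow>\<^sub>E carrier G \<subseteq> carrier H \<rightarrow>\<^sub>E UNIV"
      by (intro PiE_mono) simp
    ultimately show "f = f' \<and> h = h'"
      using e by (auto simp: wreath_def dest: inj_onD)
  qed
  then show ?thesis by blast
qed

theorem lemma3p12:
  fixes R :: "'r ring"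
    and T :: "('g::infinite, 'r, 'm) homology_data"
    and \<F> :: "'g monoid \<Rightarrow> bool"
  assumes "ring R"
    and "equivariant_homology_theory R T"
    and "closed_group_class \<F>"
    and "\<forall>G :: 'g monoid. virtually_abelian G \<longrightarrow> FIC_holds T \<F> G"
  shows "\<forall>G :: 'g monoid. virtually_abelian G \<longrightarrow> FICwF_holds T \<F> G"
  unfolding FICwF_holds_def
proof (intro allI impI, elim conjE)
  fix G H :: "'g monoid"
  assume "virtually_abelian G" and H: "group H" "finite (carrier H)"
  then have va: "virtually_abelian (wreath G H)"
    by (intro virtually_abelian_wreath)
  then interpret W: group "wreath G H"
    by (simp add: virtually_abelian_def)
  obtain e :: "('g \<Rightarrow> 'g) \<times> 'g \<Rightarrow> 'g" where e: "inj_on e (carrier (wreath G H))"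
    using inj_on_wreath[OF H(2)] by blast
  \<comment> \<open>\<open>image_group\<close> transports the multiplication along \<open>e\<close>,
    giving a copy whose elements lie in the universe \<open>'g\<close>, where the assumption on
    virtually abelian groups applies.\<close>
  have iso: "e \<in> iso (wreath G H) (image_group e (wreath G H))"
    using e by (rule inj_imp_image_group_iso)
  have grp: "group (image_group e (wreath G H))"
    using e by (rule W.inj_imp_image_group_is_group)
  have "FIC_holds T \<F> (image_group e (wreath G H))"
    using assms(4) virtually_abelian_iso[OF iso grp va] by blast
  then show "FIC_holds T \<F> (wreath G H)"
    by (rule FIC_holds_iso[OF iso W.is_group grp])
qed

end
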